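(* $\pi((\square P)^3)\le 28$.
   Context: $P$ is the two-way infinite path with vertex set $\mathbb{Z}$ ($i\sim i+1$). $(\square P)^3$ is the $3$-fold Cartesian product of $P$, i.e. the graph on $\mathbb{Z}^3$ in which two vertices are adjacent iff they differ by exactly $1$ in exactly one coordinate. A vertex coloring $c$ of a graph is non-repetitive if there is no path $v_1,\dots,v_{2k}$ ($k\ge1$, distinct vertices, consecutive ones adjacent) with $c(v_i)=c(v_{k+i})$ for all $1\le i\le k$; $\pi(G)$ denotes the minimum number of colors in a non-repetitive coloring of $G$. *)

theory Defs
  imports
    "Graph_Theory.Pair_Digraph"
    "Graph_Theory.Vertex_Walk"
    "HOL-Library.Extended_Nat"
begin

text \<open>An undirected simple graph is a \<^term>\<open>pair_bidirected_digraph\<close>: each edge is represented by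
  its two opposite arcs. Vertex sets may be infinite.\<close>

definition two_way_path :: "int pair_pre_digraph" where
  "two_way_path = \<lparr> pverts = UNIV, parcs = {(i, j). \<bar>i - j\<bar> = 1} \<rparr>"

text \<open>The vertices of the n-fold Cartesian power are the n-tuples of vertices, encoded as lists
  of length n.\<close>

definition cartesian_power :: "'a pair_pre_digraph \<Rightarrow> nat \<Rightarrow> 'a list pair_pre_digraph" where
  "cartesian_power G n =
     (let V = {xs. length xs = n \<and> set xs \<subseteq> pverts G} in
      \<lparr> pverts = V,
        parcs = {(xs, ys). xs \<in> V \<and> ys \<in> V \<and>
          (\<exists>i<n. (xs ! i, ys ! i) \<in> parcs G \<and> (\<forall>j<n. j \<noteq> i \<longrightarrow> xs ! j = ys ! j))} \<rparr>)"

definition nonrepetitive :: "'a pair_pre_digraph \<Rightarrow> ('a \<Rightarrow> 'c) \<Rightarrow> bool" where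
  "nonrepetitive G c \<longleftrightarrow>
     \<not> (\<exists>p k. vpath p (with_proj G) \<and> k \<ge> 1 \<and> length p = 2 * k \<and>
            (\<forall>i<k. c (p ! i) = c (p ! (k + i))))"

text \<open>The value is \<open>\<infinity>\<close> when no finite number of colours suffices.\<close>

definition nonrepetitive_number :: "'a pair_pre_digraph \<Rightarrow> enat" where
  "nonrepetitive_number G =
     Inf {enat k | k. \<exists>c :: 'a \<Rightarrow> nat. c ` pverts G \<subseteq> {..<k} \<and> nonrepetitive G c}"

lemma pair_bidirected_digraph_two_way_path: "pair_bidirected_digraph two_way_path"
  by unfold_locales (auto simp: two_way_path_def symmetric_def intro!: symI)

lemma pair_bidirected_digraph_cartesian_power:
  assumes "pair_bidirected_digraph G"
  shows "pair_bidirected_digraph (cartesian_power G n)"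
proof -
  interpret pair_bidirected_digraph G by fact
  have sym: "(v, u) \<in> parcs G" if "(u, v) \<in> parcs G" for u v
    using pair_sym_arcs that by (auto simp: symmetric_def dest: symD)
  show ?thesis
  proof
    fix e assume "e \<in> parcs (cartesian_power G n)"
    then obtain xs ys i where e: "e = (xs, ys)"
      and V: "xs \<in> pverts (cartesian_power G n)" "ys \<in> pverts (cartesian_power G n)"
      and i: "(xs ! i, ys ! i) \<in> parcs G"
      by (auto simp: cartesian_power_def Let_def)
    from e V show "fst e \<in> pverts (cartesian_power G n)" "snd e \<in> pverts (cartesian_power G n)"
      by simp_all
    from e i show "fst e \<noteq> snd e"
      by (auto dest: no_loops')
  next
    have "(ys, xs) \<in> parcs (cartesian_power G n)"
      if "(xs, ys) \<in> parcs (cartesian_power G n)" for xs ys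
    proof -
      from that obtain i where "i < n" "(xs ! i, ys ! i) \<in> parcs G"
        and "\<forall>j<n. j \<noteq> i \<longrightarrow> xs ! j = ys ! j"
        by (auto simp: cartesian_power_def Let_def)
      then have "\<exists>i<n. (ys ! i, xs ! i) \<in> parcs G \<and> (\<forall>j<n. j \<noteq> i \<longrightarrow> ys ! j = xs ! j)"
        using sym by (intro exI[of _ i]) auto
      with that show ?thesis
        by (simp add: cartesian_power_def Let_def)
    qed
    then show "symmetric (with_proj (cartesian_power G n))"
      by (simp add: symmetric_def sym_def)
  qed
qed

lemma parcs_two_way_path_power_3:
  "([x, y, z], [x', y', z']) \<in> parcs (cartesian_power two_way_path 3) \<longleftrightarrow>
     \<bar>x - x'\<bar> = 1 \<and> y = y' \<and> z = z' \<or>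
     x = x' \<and> \<bar>y - y'\<bar> = 1 \<and> z = z' \<or>
     x = x' \<and> y = y' \<and> \<bar>z - z'\<bar> = 1"
proof -
  have ex3: "(\<exists>i<3. P i) \<longleftrightarrow> P 0 \<or> P 1 \<or> P 2" and all3: "(\<forall>i<3. P i) \<longleftrightarrow> P 0 \<and> P 1 \<and> P 2"
    for P :: "nat \<Rightarrow> bool"
    by (auto simp: numeral_3_eq_3 less_Suc_eq numeral_2_eq_2)
  show ?thesis
    by (simp add: cartesian_power_def two_way_path_def ex3 all3) blast
qed

end

theory Submission
  imports Defs
begin

text \<open>Colour \<open>(x, y, z)\<close> by the pair of \<open>x + 2 y + 3 z mod 7\<close> and \<open>t x + t y + t z\<close>, where \<open>t\<close> is a
  two-sided Thue--Morse word over \<open>{0, 1}\<close>. The six unit steps change \<open>x + 2 y + 3 z\<close> by distinct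
  residues modulo 7, so in a repetition the second half is a translate of the first by some vector
  \<open>d\<close>, and the second component then shows that in each coordinate separately \<open>t\<close> is repeated, up to
  a constant, under the shift by \<open>d\<^sub>j\<close>. In every coordinate except that of the step joining the two
  halves, this yields an overlap in \<open>t\<close> unless \<open>d\<^sub>j = 0\<close>. Hence \<open>d\<close> is parallel to an axis, its
  length is a multiple of 7, and \<open>t\<close> contains a square of that period; but the periods of squares in
  the Thue--Morse word are \<open>2\<^sup>n\<close> and \<open>3 * 2\<^sup>n\<close>.\<close>

section \<open>The two-sided Thue--Morse word\<close>

fun thue_morse :: "nat \<Rightarrow> bool" where
  "thue_morse n = (if n = 0 then False else thue_morse (n div 2) \<noteq> odd n)"

declare thue_morse.simps [simp del]

lemma thue_morse_double [simp]: "thue_morse (2 * n) = thue_morse n"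
  by (subst thue_morse.simps) (auto simp: thue_morse.simps [of 0])

lemma thue_morse_Suc_double [simp]: "thue_morse (Suc (2 * n)) = (\<not> thue_morse n)"
  by (subst thue_morse.simps) auto

text \<open>There are two ways to extend the word to the left. Halving the positions exchanges them, so
  both are treated together.\<close>

definition thue_morse_int :: "bool \<Rightarrow> int \<Rightarrow> bool" where
  "thue_morse_int b n = (if n \<ge> 0 then thue_morse (nat n) else thue_morse (nat (- 1 - n)) \<noteq> b)"

text \<open>The reflection of \<open>n\<close> to \<open>- 1 - n\<close> exchanges even and odd
  positions, so left of 0 the doubling rules pick up an extra negation, which flips
  \<open>b\<close>.\<close>

lemma thue_morse_int_even [simp]: "thue_morse_int b (2 * n) = thue_morse_int (\<not> b) n"
proof (cases "n \<ge> 0")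
  case True
  then show ?thesis by (simp add: thue_morse_int_def nat_mult_distrib)
next
  case False
  then have "nat (- 1 - 2 * n) = Suc (2 * nat (- 1 - n))" by simp
  with False show ?thesis by (simp add: thue_morse_int_def)
qed

lemma thue_morse_int_odd [simp]: "thue_morse_int b (2 * n + 1) = (\<not> thue_morse_int (\<not> b) n)"
proof (cases "n \<ge> 0")
  case True
  then have "nat (2 * n + 1) = Suc (2 * nat n)" by simp
  with True show ?thesis by (simp add: thue_morse_int_def)
next
  case False
  then have "nat (- 1 - (2 * n + 1)) = 2 * nat (- 1 - n)" by simp
  with False show ?thesis by (simp add: thue_morse_int_def)
qed

text \<open>The word is a sequence of blocks 01 and 10 that start at even positions.\<close>

lemma thue_morse_int_even_Suc:
  assumes "even i" shows "thue_morse_int b (i + 1) \<noteq> thue_morse_int b i"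
  using assms by (auto elim!: evenE)

text \<open>One of \<open>i\<close>, \<open>i + 1\<close> is even and starts a block, which has two
  different letters.\<close>

lemma thue_morse_int_cube_free:
  "\<not> (thue_morse_int b (i + 1) = thue_morse_int b i
     \<and> thue_morse_int b (i + 2) = thue_morse_int b (i + 1))"
  using thue_morse_int_even_Suc [of i b] thue_morse_int_even_Suc [of "i + 1" b]
  by (cases "even i") (auto simp: add.assoc)

text \<open>If the letters differ across the border of two blocks, the blocks have the same first
  letter. Four steps cross two such borders, which gives three equal letters in the word of first
  letters.\<close>

lemma thue_morse_int_not_alternating:
  "\<exists>i\<in>{a..<a + 4}. thue_morse_int b (i + 1) = thue_morse_int b i"
proof (rule ccontr)
  assume "\<not> ?thesis"
  then have alt: "thue_morse_int b (i + 1) \<noteq> thue_morse_int b i" if "a \<le> i" "i < a + 4" for i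
    using that by auto
  define m where "m = a div 2"
  let ?w = "thue_morse_int (\<not> b)"
  have eq: "?w (n + 1) = ?w n" if "a \<le> 2 * n + 1" "2 * n + 1 < a + 4" for n
    using alt [OF that] thue_morse_int_even [of b "n + 1"] thue_morse_int_odd [of b n]
    by (simp add: algebra_simps)
  show False
  proof (rule notE [OF thue_morse_int_cube_free [of "\<not> b" m]])
    show "?w (m + 1) = ?w m \<and> ?w (m + 2) = ?w (m + 1)"
      using eq [of m] eq [of "m + 1"] unfolding m_def by (simp add: add.assoc)
  qed
qed

lemma alternating_parity:
  fixes w :: "int \<Rightarrow> bool"
  assumes "\<And>i. a \<le> i \<Longrightarrow> i < a + int n \<Longrightarrow> w (i + 1) \<noteq> w i"
  shows "w (a + int n) = w a \<longleftrightarrow> even n"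
  using assms
proof (induction n)
  case (Suc n)
  from Suc.prems [of "a + int n"] have "w (a + int (Suc n)) \<noteq> w (a + int n)"
    by (simp add: algebra_simps)
  with Suc show ?case by auto
qed simp

text \<open>For odd \<open>p\<close>, the shift by \<open>p\<close> carries odd positions to even ones.\<close>

lemma thue_morse_int_odd_shift_alternating:
  assumes "odd p" and "\<And>i. a \<le> i \<Longrightarrow> i \<le> m \<Longrightarrow> thue_morse_int b (i + p) = thue_morse_int b i"
    and "a \<le> i" "i < m"
  shows "thue_morse_int b (i + 1) \<noteq> thue_morse_int b i"
  using assms(1) assms(2) [of i] assms(2) [of "i + 1"] assms(3,4)
    thue_morse_int_even_Suc [of i b] thue_morse_int_even_Suc [of "i + p" b]
  by (auto simp: ac_simps)

text \<open>Induction on the period. If it is even, the overlap passes to the word of first letters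
  of the blocks, with half the period. If it is odd, the letters alternate from \<open>a\<close> to
  \<open>a + p\<close> and so differ at these two ends.\<close>

lemma thue_morse_int_overlap_free:
  assumes "p > 0"
  shows "\<exists>i\<in>{a..a + p}. thue_morse_int b (i + p) \<noteq> thue_morse_int b i"
  using assms
proof (induction "nat p" arbitrary: p a b rule: less_induct)
  case less
  show ?case
  proof (rule ccontr)
    assume "\<not> ?thesis"
    then have rep: "thue_morse_int b (i + p) = thue_morse_int b i" if "a \<le> i" "i \<le> a + p" for i
      using that by auto
    show False
    proof (cases "even p")
      case True
      then obtain q where q: "p = 2 * q" ..
      with less.prems less.hyps [of q "a div 2" "\<not> b"]
      have "\<exists>n\<in>{a div 2..a div 2 + q}. thue_morse_int (\<not> b) (n + q) \<noteq> thue_morse_int (\<not> b) n" by simp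
      then obtain n where n: "a div 2 \<le> n" "n \<le> a div 2 + q"
        and neq: "thue_morse_int (\<not> b) (n + q) \<noteq> thue_morse_int (\<not> b) n"
        unfolding Bex_def atLeastAtMost_iff by blast
      \<comment> \<open>\<open>2 * n\<close> lies in the window if \<open>a\<close> is even,
        \<open>2 * n + 1\<close> if \<open>a\<close> is odd.\<close>
      have "a \<le> 2 * n \<and> 2 * n \<le> a + p \<or> a \<le> 2 * n + 1 \<and> 2 * n + 1 \<le> a + p"
        using n q by linarith
      moreover have "2 * n + p = 2 * (n + q)" "2 * n + 1 + p = 2 * (n + q) + 1"
        using q by simp_all
      ultimately show False
        using rep neq by (metis thue_morse_int_even thue_morse_int_odd)
    next
      case False
      have "thue_morse_int b (a + int (nat p)) = thue_morse_int b a \<longleftrightarrow> even (nat p)"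
      proof (rule alternating_parity)
        fix i assume "a \<le> i" "i < a + int (nat p)"
        then have i: "a \<le> i" "i < a + p" using less.prems by simp_all
        show "thue_morse_int b (i + 1) \<noteq> thue_morse_int b i"
          by (rule thue_morse_int_odd_shift_alternating [OF False _ i]) (rule rep)
      qed
      with False rep [of a] less.prems show False by (auto simp: even_nat_iff)
    qed
  qed
qed

text \<open>Halving an even period keeps it a multiple of 7, so an odd period is at least 7. It
  forces \<open>p - 1\<close> alternating steps, but four in a row are impossible.\<close>

lemma thue_morse_int_no_square_mult_7:
  assumes "p > 0" "7 dvd p"
  shows "\<exists>i\<in>{a..<a + p}. thue_morse_int b (i + p) \<noteq> thue_morse_int b i"
  using assms
proof (induction "nat p" arbitrary: p a b rule: less_induct)
  case less
  show ?case
  proof (rule ccontr)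
    assume "\<not> ?thesis"
    then have rep: "thue_morse_int b (i + p) = thue_morse_int b i" if "a \<le> i" "i \<le> a + p - 1" for i
      using that by auto
    show False
    proof (cases "even p")
      case True
      then obtain q where q: "p = 2 * q" ..
      with less.prems have "7 dvd q" by presburger
      with q less.prems less.hyps [of q "a div 2" "\<not> b"]
      have "\<exists>n\<in>{a div 2..<a div 2 + q}. thue_morse_int (\<not> b) (n + q) \<noteq> thue_morse_int (\<not> b) n" by simp
      then obtain n where n: "a div 2 \<le> n" "n < a div 2 + q"
        and neq: "thue_morse_int (\<not> b) (n + q) \<noteq> thue_morse_int (\<not> b) n"
        unfolding Bex_def atLeastLessThan_iff by blast
      have "a \<le> 2 * n \<and> 2 * n \<le> a + p - 1 \<or> a \<le> 2 * n + 1 \<and> 2 * n + 1 \<le> a + p - 1"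
        using n q by linarith
      moreover have "2 * n + p = 2 * (n + q)" "2 * n + 1 + p = 2 * (n + q) + 1"
        using q by simp_all
      ultimately show False
        using rep neq by (metis thue_morse_int_even thue_morse_int_odd)
    next
      case False
      from less.prems have "p \<ge> 7" by (simp add: zdvd_imp_le)
      have "thue_morse_int b (i + 1) \<noteq> thue_morse_int b i" if "a \<le> i" "i < a + p - 1" for i
        by (rule thue_morse_int_odd_shift_alternating [OF False _ that]) (rule rep)
      with \<open>p \<ge> 7\<close> thue_morse_int_not_alternating [of a b] show False by force
    qed
  qed
qed

section \<open>Walks whose colours are preserved by a translation\<close>

text \<open>A walk with steps of at most 1 visits every integer between its ends, so a relation
  along the walk holds on an interval.\<close>

lemma shift_window:
  fixes f :: "nat \<Rightarrow> int" and w :: "int \<Rightarrow> int"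
  assumes step: "\<And>i. i < m \<Longrightarrow> \<bar>f (i + 1) - f i\<bar> \<le> 1"
    and shift: "\<And>i. i \<le> m \<Longrightarrow> w (f i + d) - w (f i) = e"
  obtains a e' where "\<And>t. a \<le> t \<Longrightarrow> t \<le> a + \<bar>f m - f 0\<bar> \<Longrightarrow> w (t + \<bar>d\<bar>) - w t = e'"
proof -
  define l where "l = min (f 0) (f m)"
  have window: "w (t + d) - w t = e" if "l \<le> t" "t \<le> l + \<bar>f m - f 0\<bar>" for t
  proof -
    have "\<exists>i\<le>m. f i = t"
    proof (cases "f 0 \<le> f m")
      case True
      then show ?thesis
        using nat0_intermed_int_val [of m f t] step that by (auto simp: l_def)
    next
      case False
      have "\<bar>- f (i + 1) - - f i\<bar> \<le> 1" if "i < m" for i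
        using step [OF that] by linarith
      with False show ?thesis
        using nat0_intermed_int_val [of m "\<lambda>i. - f i" "- t"] that by (auto simp: l_def)
    qed
    with shift show ?thesis by auto
  qed
  show thesis
  proof (cases "d \<ge> 0")
    case True
    with window show ?thesis by (intro that [of l e]) auto
  next
    case False
    \<comment> \<open>A negative shift is read backwards: the window moves by \<open>d\<close> and
      the difference changes sign.\<close>
    have "w (t + \<bar>d\<bar>) - w t = - e" if "l + d \<le> t" "t \<le> l + d + \<bar>f m - f 0\<bar>" for t
      using window [of "t - d"] that False by simp
    then show ?thesis by (rule that)
  qed
qed

text \<open>Letters become numbers because the colour adds them over the coordinates.\<close>

abbreviation (input) tm :: "int \<Rightarrow> int" where
  "tm n \<equiv> of_bool (thue_morse_int False n)"

text \<open>For a coordinate fixed by the step that joins the halves: the window has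
  \<open>\<bar>d\<bar> + 1\<close> positions, enough for an overlap.\<close>

lemma tm_full_shift:
  fixes f :: "nat \<Rightarrow> int"
  assumes "\<And>i. i < m \<Longrightarrow> \<bar>f (i + 1) - f i\<bar> \<le> 1"
    and "\<And>i. i \<le> m \<Longrightarrow> tm (f i + d) - tm (f i) = e"
    and "f m = f 0 + d"
  shows "d = 0"
proof (rule ccontr)
  assume "d \<noteq> 0"
  define p where "p = \<bar>d\<bar>"
  with \<open>d \<noteq> 0\<close> have "p > 0" by simp
  obtain a e' where "\<And>t. a \<le> t \<Longrightarrow> t \<le> a + \<bar>f m - f 0\<bar> \<Longrightarrow> tm (t + \<bar>d\<bar>) - tm t = e'"
    by (rule shift_window [where f = f and w = tm and m = m, OF assms(1,2)]) blast+
  then have win: "tm (t + p) - tm t = e'" if "a \<le> t" "t \<le> a + p" for t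
    using that assms(3) unfolding p_def by simp
  \<comment> \<open>The differences at \<open>a\<close> and \<open>a + p\<close> add up to
    \<open>2 * e'\<close>, which is a difference of two letters.\<close>
  have "e' = 0"
    using win [of a] win [of "a + p"] \<open>p > 0\<close> by (auto simp: of_bool_def split: if_splits)
  with win thue_morse_int_overlap_free [OF \<open>p > 0\<close>, of a False] show False
    by (force simp: of_bool_def split: if_splits)
qed

text \<open>For the coordinate changed by the joining step: one position may be lost, so only a
  square remains.\<close>

lemma tm_almost_full_shift:
  fixes f :: "nat \<Rightarrow> int"
  assumes "\<And>i. i < m \<Longrightarrow> \<bar>f (i + 1) - f i\<bar> \<le> 1"
    and "\<And>i. i \<le> m \<Longrightarrow> tm (f i + d) - tm (f i) = e"
    and "\<bar>f 0 + d - f m\<bar> \<le> 1" and "7 dvd d"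
  shows "d = 0"
proof (rule ccontr)
  assume "d \<noteq> 0"
  define p where "p = \<bar>d\<bar>"
  with \<open>d \<noteq> 0\<close> assms(4) have "p > 0" "7 dvd p" by simp_all
  then have "p \<ge> 7" by (simp add: zdvd_imp_le)
  obtain a e' where "\<And>t. a \<le> t \<Longrightarrow> t \<le> a + \<bar>f m - f 0\<bar> \<Longrightarrow> tm (t + \<bar>d\<bar>) - tm t = e'"
    by (rule shift_window [where f = f and w = tm and m = m, OF assms(1,2)]) blast+
  then have win: "tm (t + p) - tm t = e'" if "a \<le> t" "t < a + p" for t
    using that assms(3) unfolding p_def by auto
  \<comment> \<open>A nonzero \<open>e'\<close> determines the letter at every position of the
    window, so three equal letters would be adjacent.\<close>
  have "e' = 0"
    using win [of a] win [of "a + 1"] win [of "a + 2"] \<open>p \<ge> 7\<close> thue_morse_int_cube_free [of False a]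
    by (auto simp: of_bool_def split: if_splits)
  with win thue_morse_int_no_square_mult_7 [OF \<open>p > 0\<close> \<open>7 dvd p\<close>, of a False] show False
    by (force simp: of_bool_def split: if_splits)
qed

definition unit_step :: "int \<times> int \<times> int \<Rightarrow> bool" where
  "unit_step d \<longleftrightarrow> d \<in> {(1, 0, 0), (-1, 0, 0), (0, 1, 0), (0, -1, 0), (0, 0, 1), (0, 0, -1)}"

text \<open>The weights 1, 2, 3 give the six steps the residues 1, 6, 2, 5, 3, 4.\<close>

lemma unit_step_eqI:
  assumes "unit_step (a, b, c)" "unit_step (a', b', c')"
    and "(a + 2 * b + 3 * c) mod 7 = (a' + 2 * b' + 3 * c') mod 7"
  shows "a = a'" "b = b'" "c = c'"
  using assms by (auto simp: unit_step_def)

lemma repetitive_grid_walk_returns: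
  fixes x y z :: "nat \<Rightarrow> int"
  assumes k: "k \<ge> 1"
    and step: "\<And>i. i + 1 < 2 * k \<Longrightarrow>
      unit_step (x (i + 1) - x i, y (i + 1) - y i, z (i + 1) - z i)"
    and residue: "\<And>i. i < k \<Longrightarrow>
      (x i + 2 * y i + 3 * z i) mod 7 = (x (k + i) + 2 * y (k + i) + 3 * z (k + i)) mod 7"
    and height: "\<And>i. i < k \<Longrightarrow>
      tm (x i) + tm (y i) + tm (z i) = tm (x (k + i)) + tm (y (k + i)) + tm (z (k + i))"
  shows "x k = x 0 \<and> y k = y 0 \<and> z k = z 0"
proof -
  define dx dy dz where "dx = x k - x 0" and "dy = y k - y 0" and "dz = z k - z 0"
  note d_defs = dx_def dy_def dz_def
  have same_step: "x (k + (i + 1)) - x (k + i) = x (i + 1) - x i \<and>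
      y (k + (i + 1)) - y (k + i) = y (i + 1) - y i \<and>
      z (k + (i + 1)) - z (k + i) = z (i + 1) - z i" if "i + 1 < k" for i
  proof -
    have *: "unit_step (x (i + 1) - x i, y (i + 1) - y i, z (i + 1) - z i)"
      using step [of i] that by simp
    have **: "unit_step (x (k + (i + 1)) - x (k + i), y (k + (i + 1)) - y (k + i),
        z (k + (i + 1)) - z (k + i))"
      using step [of "k + i"] that by (simp add: add.assoc)
    have "((x (i + 1) - x i) + 2 * (y (i + 1) - y i) + 3 * (z (i + 1) - z i)) mod 7 =
        ((x (i + 1) + 2 * y (i + 1) + 3 * z (i + 1)) - (x i + 2 * y i + 3 * z i)) mod 7"
      by (simp add: algebra_simps)
    also have "\<dots> = ((x (k + (i + 1)) + 2 * y (k + (i + 1)) + 3 * z (k + (i + 1)))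
        - (x (k + i) + 2 * y (k + i) + 3 * z (k + i))) mod 7"
      using residue [of i] residue [of "i + 1"] that by (intro mod_diff_cong) auto
    also have "\<dots> = ((x (k + (i + 1)) - x (k + i)) + 2 * (y (k + (i + 1)) - y (k + i))
        + 3 * (z (k + (i + 1)) - z (k + i))) mod 7"
      by (simp add: algebra_simps)
    finally show ?thesis using unit_step_eqI [OF * **] by metis
  qed
  have translate: "x (k + i) = x i + dx \<and> y (k + i) = y i + dy \<and> z (k + i) = z i + dz"
    if "i < k" for i
    using that
  proof (induction i)
    case (Suc i)
    then show ?case using same_step [of i] by simp
  qed (simp add: d_defs)
  define e where "e u d = tm (u + d) - tm u" for u d
  \<comment> \<open>The three differences sum to 0, and a step alters only one coordinate. Two of
    them stay the same, hence so does the third.\<close>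
  have shifts: "e (x i) dx = e (x 0) dx \<and> e (y i) dy = e (y 0) dy \<and> e (z i) dz = e (z 0) dz"
    if "i < k" for i
    using that
  proof (induction i)
    case (Suc i)
    have sum0: "e (x j) dx + e (y j) dy + e (z j) dz = 0" if "j < k" for j
      using height [OF that] translate [OF that] by (simp add: e_def)
    have "e (x (Suc i)) dx = e (x i) dx \<and> e (y (Suc i)) dy = e (y i) dy \<and> e (z (Suc i)) dz = e (z i) dz"
      using step [of i] Suc.prems sum0 [of i] sum0 [of "Suc i"]
      unfolding unit_step_def by auto
    with Suc show ?case by simp
  qed simp
  \<comment> \<open>The first half ends at \<open>m\<close>; the step from \<open>m\<close> to
    \<open>k\<close> joins the halves.\<close>
  define m where "m = k - 1"
  have k_eq: "k = m + 1" using k by (simp add: m_def)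
  have xyz_step: "\<bar>x (i + 1) - x i\<bar> \<le> 1" "\<bar>y (i + 1) - y i\<bar> \<le> 1" "\<bar>z (i + 1) - z i\<bar> \<le> 1"
    if "i < m" for i
    using step [of i] that k_eq by (auto simp: unit_step_def)
  have shift_x: "tm (x i + dx) - tm (x i) = e (x 0) dx"
    and shift_y: "tm (y i + dy) - tm (y i) = e (y 0) dy"
    and shift_z: "tm (z i + dz) - tm (z i) = e (z 0) dz" if "i \<le> m" for i
    using shifts [of i] that k_eq by (auto simp: e_def)
  note full =
    tm_full_shift [where f = x and m = m, OF xyz_step(1) shift_x]
    tm_full_shift [where f = y and m = m, OF xyz_step(2) shift_y]
    tm_full_shift [where f = z and m = m, OF xyz_step(3) shift_z]
  note almost_full =
    tm_almost_full_shift [where f = x and m = m, OF xyz_step(1) shift_x]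
    tm_almost_full_shift [where f = y and m = m, OF xyz_step(2) shift_y]
    tm_almost_full_shift [where f = z and m = m, OF xyz_step(3) shift_z]
  have "(x k + 2 * y k + 3 * z k) mod 7 = (x 0 + 2 * y 0 + 3 * z 0) mod 7"
    using residue [of 0] k by simp
  then have "7 dvd (x k + 2 * y k + 3 * z k) - (x 0 + 2 * y 0 + 3 * z 0)"
    by (simp add: mod_eq_dvd_iff)
  \<comment> \<open>Once two components vanish, the third is a multiple of 7, as the weights are
    prime to 7.\<close>
  then have dvd: "7 dvd dx + 2 * dy + 3 * dz"
    by (simp add: d_defs algebra_simps)
  have last: "unit_step (x k - x m, y k - y m, z k - z m)"
    using step [of m] k_eq by simp
  then consider "y k = y m" "z k = z m" "\<bar>x k - x m\<bar> \<le> 1"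
    | "x k = x m" "z k = z m" "\<bar>y k - y m\<bar> \<le> 1"
    | "x k = x m" "y k = y m" "\<bar>z k - z m\<bar> \<le> 1"
    by (auto simp: unit_step_def)
  then have "dx = 0 \<and> dy = 0 \<and> dz = 0"
  proof cases
    case 1
    then have "dy = 0" "dz = 0" using full by (auto simp: d_defs)
    moreover from this dvd 1 have "dx = 0" using almost_full(1) by (simp add: d_defs)
    ultimately show ?thesis by simp
  next
    case 2
    then have "dx = 0" "dz = 0" using full by (auto simp: d_defs)
    moreover from this dvd have "7 dvd dy" by presburger
    with 2 have "dy = 0" using almost_full(2) by (simp add: d_defs)
    ultimately show ?thesis by simp
  next
    case 3
    then have "dx = 0" "dy = 0" using full by (auto simp: d_defs)
    moreover from this dvd have "7 dvd dz" by presburger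
    with 3 have "dz = 0" using almost_full(3) by (simp add: d_defs)
    ultimately show ?thesis by simp
  qed
  then show ?thesis by (simp add: d_defs)
qed

section \<open>The colouring of the cubic grid\<close>

text \<open>The pair is written in base 7: four sums times seven residues make 28 colours.\<close>

definition grid_colour :: "int list \<Rightarrow> nat" where
  "grid_colour v = nat (7 * (tm (v ! 0) + tm (v ! 1) + tm (v ! 2))
     + (v ! 0 + 2 * v ! 1 + 3 * v ! 2) mod 7)"

lemma grid_colour_less: "grid_colour v < 28"
proof -
  let ?s = "tm (v ! 0) + tm (v ! 1) + tm (v ! 2)" and ?r = "(v ! 0 + 2 * v ! 1 + 3 * v ! 2) mod 7"
  have bound: "7 * s + r < 28" if "s \<le> 3" "r < 7" for s r :: int
    using that by simp
  have "7 * ?s + ?r < 28"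
    by (rule bound) (simp_all add: of_bool_def)
  then have "nat (7 * ?s + ?r) < nat 28" by (simp only: zless_nat_conj) simp
  then show ?thesis by (simp add: grid_colour_def)
qed

lemma grid_colour_eqD:
  assumes "grid_colour u = grid_colour v"
  shows "(u ! 0 + 2 * u ! 1 + 3 * u ! 2) mod 7 = (v ! 0 + 2 * v ! 1 + 3 * v ! 2) mod 7"
    and "tm (u ! 0) + tm (u ! 1) + tm (u ! 2) = tm (v ! 0) + tm (v ! 1) + tm (v ! 2)"
proof -
  define s where "s v = tm (v ! 0) + tm (v ! 1) + tm (v ! 2)" for v
  define r where "r v = (v ! 0 + 2 * v ! 1 + 3 * v ! 2) mod 7" for v :: "int list"
  have pos: "s v \<ge> 0" "0 \<le> r v" "r v < 7" for v by (simp_all add: s_def r_def)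
  have "nat (7 * s u + r u) = nat (7 * s v + r v)"
    using assms by (simp only: grid_colour_def s_def r_def)
  then have "7 * s u + r u = 7 * s v + r v"
    using pos [of u] pos [of v] by linarith
  then have "r u = r v \<and> s u = s v"
    using pos [of u] pos [of v] by presburger
  then show "(u ! 0 + 2 * u ! 1 + 3 * u ! 2) mod 7 = (v ! 0 + 2 * v ! 1 + 3 * v ! 2) mod 7"
    and "tm (u ! 0) + tm (u ! 1) + tm (u ! 2) = tm (v ! 0) + tm (v ! 1) + tm (v ! 2)"
    by (simp_all add: r_def s_def)
qed

lemma nth_vwalk_arc:
  assumes "vwalk p (with_proj G)" "Suc i < length p"
  shows "(p ! i, p ! Suc i) \<in> parcs G"
  using assms
proof (induction p arbitrary: i rule: list.induct)
  case (Cons u p)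
  show ?case
  proof (cases p)
    case Nil
    with Cons.prems show ?thesis by simp
  next
    case [simp]: (Cons v q)
    from Cons.prems(1) have "(u, v) \<in> parcs G" "vwalk p (with_proj G)"
      by (auto simp: vwalk_def)
    with Cons.IH Cons.prems(2) show ?thesis by (cases i) auto
  qed
qed simp

lemma unit_step_of_arc:
  assumes "(u, v) \<in> parcs (cartesian_power two_way_path 3)"
  shows "unit_step (v ! 0 - u ! 0, v ! 1 - u ! 1, v ! 2 - u ! 2)"
proof -
  have "length u = 3" "length v = 3"
    using assms by (auto simp: cartesian_power_def Let_def)
  then obtain x y z x' y' z' where "u = [x, y, z]" "v = [x', y', z']"
    by (auto simp: length_Suc_conv numeral_3_eq_3)
  with assms show ?thesis
    by (auto simp: parcs_two_way_path_power_3 unit_step_def abs_if split: if_splits)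
qed

lemma nonrepetitive_grid_colour:
  "nonrepetitive (cartesian_power two_way_path 3) grid_colour"
  unfolding nonrepetitive_def
proof (rule notI, elim exE conjE)
  let ?G = "cartesian_power two_way_path 3"
  fix p k
  assume path: "vpath p (with_proj ?G)" and k: "1 \<le> k" and len: "length p = 2 * k"
    and rep: "\<forall>i<k. grid_colour (p ! i) = grid_colour (p ! (k + i))"
  have walk: "vwalk p (with_proj ?G)" and dist: "distinct p"
    using path by (auto simp: vpath_def)
  have length3: "length (p ! i) = 3" if "i < 2 * k" for i
  proof -
    have "p ! i \<in> pverts ?G" using walk that len nth_mem [of i p] by (auto simp: vwalk_def)
    then show ?thesis by (simp add: cartesian_power_def Let_def)
  qed
  have "p ! k ! 0 = p ! 0 ! 0 \<and> p ! k ! 1 = p ! 0 ! 1 \<and> p ! k ! 2 = p ! 0 ! 2"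
  proof (rule repetitive_grid_walk_returns [OF k, where x = "\<lambda>i. p ! i ! 0" and y = "\<lambda>i. p ! i ! 1"
        and z = "\<lambda>i. p ! i ! 2"])
    fix i assume "i + 1 < 2 * k"
    then show "unit_step (p ! (i + 1) ! 0 - p ! i ! 0, p ! (i + 1) ! 1 - p ! i ! 1,
        p ! (i + 1) ! 2 - p ! i ! 2)"
      using unit_step_of_arc [OF nth_vwalk_arc [OF walk, of i]] len by simp
  qed (use rep grid_colour_eqD in blast)+
  moreover have "length (p ! k) = 3" "length (p ! 0) = 3" using length3 k by simp_all
  ultimately have "p ! k = p ! 0"
    by (auto simp: list_eq_iff_nth_eq less_Suc_eq numeral_3_eq_3 numeral_2_eq_2)
  \<comment> \<open>\<open>0\<close> and \<open>k\<close> are different positions of the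
    path.\<close>
  with dist len k show False
    by (simp add: nth_eq_iff_index_eq)
qed

theorem theorem5:
  shows "nonrepetitive_number (cartesian_power two_way_path 3) \<le> 28"
proof -
  have "nonrepetitive_number (cartesian_power two_way_path 3) \<le> enat 28"
    unfolding nonrepetitive_number_def
    using nonrepetitive_grid_colour grid_colour_less by (intro Inf_lower) blast
  then show ?thesis by (simp add: numeral_eq_enat)
qed

end
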